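(* (a) As $n \to \infty$, \[ \mathbb{P}(F_n^- \le \ln n - 3\ln\ln\ln n) \to 0, \] and for every real sequence $c_n \to \infty$, \[ \mathbb{P}(F_n^- \ge \ln n + c_n) \to 0. \] (b) If $d \ge 2$, then for every $c > 0$, \[ \mathbb{P}(F_n^- \ge \ln n + c \ln\ln n \text{ infinitely often}) = 0. \] (c1) $\mathbb{P}(F_n^- \le \ln n - 3 \ln\ln\ln n \text{ infinitely often}) = 0$. (c2) $\mathbb{P}(F_n^- \le \ln n - \ln\ln\ln n \text{ infinitely often}) = 1$.
   Context: Fix an integer $d \ge 1$. Let $X^{(1)}, X^{(2)}, \dots$ be i.i.d. random vectors in $\mathbb{R}^d$ with independent Exponential$(1)$ coordinates. For $x,y \in \mathbb{R}^d$ write $x \prec y$ if $x_j<y_j$ for all $j$, $x \le y$ if $x_j \le y_j$ for all $j$, and $x_+ := \sum_j x_j$. The record-setting region at time $n$ is $\mathrm{RS}_n := \{x \in \mathbb{R}^d : 0 \le x,\ x \not\prec X^{(i)} \text{ for all } 1 \le i \le n\}$, and its frontier $F_n$ is the topological boundary of $\mathrm{RS}_n$ relative to $[0,\infty)^d$. Define $F_n^- := \min\{x_+ : x \in F_n\}$. *)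

theory Defs
  imports "HOL-Probability.Probability"
begin

definition vless :: "real^'d::finite \<Rightarrow> real^'d \<Rightarrow> bool" where
  "vless x y \<longleftrightarrow> (\<forall>j. x $ j < y $ j)"

definition orthant :: "(real^'d::finite) set" where
  "orthant = {x. \<forall>j. 0 \<le> x $ j}"

definition RS :: "(nat \<Rightarrow> real^'d::finite) \<Rightarrow> nat \<Rightarrow> (real^'d) set" where
  "RS x n = {y \<in> orthant. \<forall>i\<in>{1..n}. \<not> vless y (x i)}"

definition frontier_RS :: "(nat \<Rightarrow> real^'d::finite) \<Rightarrow> nat \<Rightarrow> (real^'d) set" where
  "frontier_RS x n = (subtopology euclidean orthant) frontier_of (RS x n)"

definition Fmin :: "(nat \<Rightarrow> real^'d::finite) \<Rightarrow> nat \<Rightarrow> real" where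
  "Fmin x n = Inf ((\<lambda>y. \<Sum>j\<in>UNIV. y $ j) ` frontier_RS x n)"

end

theory Submission
  imports Defs "HOL-Real_Asymp.Real_Asymp"
begin

text \<open>
  As soon as some observation is positive, \<open>F\<^sub>n\<^sup>-\<close> is the infimum of \<open>y\<^sub>+\<close> over all of \<open>RS\<^sub>n\<close>, because the
  segment from \<open>0\<close> to a point of the upward closed set \<open>RS\<^sub>n\<close> crosses the frontier. A fixed
  \<open>y \<ge> 0\<close> lies strictly below a given observation with probability \<open>exp (- y\<^sub>+)\<close>.

  Lower bounds: rounding up to integer points, \<open>F\<^sub>n\<^sup>- \<le> b\<close> forces one of polynomially many (in \<open>ln n\<close>)
  grid points with \<open>y\<^sub>+ \<le> b + d + 1\<close> into \<open>RS\<^sub>n\<close>; each does so with probability at most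
  \<open>exp (- n exp (- y\<^sub>+))\<close>, and with \<open>b = ln n - 3 ln ln ln n\<close> the factor \<open>exp (- const (ln ln n)\<^sup>3)\<close>
  beats every power of \<open>ln n\<close>. This is summable along \<open>n = 2\<^sup>k\<close>.

  Upper bounds: \<open>F\<^sub>n\<^sup>-\<close> is at most the maximum of any one coordinate. In dimension at least two, put
  \<open>L\<close> equally spaced points with \<open>y\<^sub>+ = b\<close> on a two-dimensional face. If \<open>F\<^sub>n\<^sup>- > b\<close>, each of them is
  dominated by an observation: either by \<open>L\<close> different ones, which has probability at most
  \<open>(n exp (- b))\<^sup>L\<close>, or some observation dominates two of the points, hence their join, whose
  coordinate sum is at least \<open>b + b / L\<close>.

  Infinitely often: apply both Borel--Cantelli lemmas to one coordinate along \<open>n\<^sub>k = k\<^bsup>2k\<^esup>\<close>. The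
  blocks \<open>(n\<^sub>k, n\<^sub>k\<^sub>+\<^sub>1]\<close> are independent and stay below the threshold with probability of order
  \<open>1 / (k ln k)\<close>, while the indices up to \<open>n\<^sub>k\<close> exceed it with summable probability.
\<close>

subsection \<open>The record-setting region and its frontier\<close>

abbreviation vsum :: "real^'d::finite \<Rightarrow> real" where
  "vsum y \<equiv> \<Sum>j\<in>UNIV. y $ j"

lemma RS_upward_closed:
  assumes "y \<in> RS x n" "\<And>j. y $ j \<le> z $ j"
  shows "z \<in> RS x n"
proof -
  have "\<not> vless z (x i)" if "i \<in> {1..n}" for i
  proof
    assume "vless z (x i)"
    hence "y $ j < x i $ j" for j
      using le_less_trans[OF assms(2)] by (simp add: vless_def)
    hence "vless y (x i)" by (simp add: vless_def)
    thus False using assms(1) that by (auto simp: RS_def)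
  qed
  moreover have "z \<in> orthant"
    using assms(1) order_trans[OF _ assms(2)] by (simp add: RS_def orthant_def)
  ultimately show ?thesis by (simp add: RS_def)
qed

lemma RS_antimono: "m \<le> n \<Longrightarrow> RS x n \<subseteq> RS x m"
  by (auto simp: RS_def)

lemma orthant_eq_Inter: "orthant = (\<Inter>j. {y. 0 \<le> y $ j})"
  by (auto simp: orthant_def)

lemma convex_orthant: "convex orthant"
  unfolding orthant_def convex_def by auto

lemma closed_orthant: "closed orthant"
  unfolding orthant_eq_Inter
  by (intro closed_INT ballI closed_Collect_le continuous_intros)

lemma closed_RS: "closed (RS x n)"
proof -
  have "RS x n = orthant \<inter> (\<Inter>i\<in>{1..n}. \<Union>j. {y. x i $ j \<le> y $ j})"
    by (auto simp: RS_def vless_def not_less)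
  also have "closed \<dots>"
    by (intro closed_Int closed_orthant closed_INT ballI closed_UN closed_Collect_le
        continuous_intros finite)
  finally show ?thesis .
qed

lemma RS_subset_orthant: "RS x n \<subseteq> orthant"
  by (auto simp: RS_def)

lemma frontier_RS_subset: "frontier_RS x n \<subseteq> RS x n"
  unfolding frontier_RS_def
  by (rule frontier_of_subset_closedin, rule closed_subset[OF RS_subset_orthant closed_RS])

lemma vsum_nonneg: "y \<in> orthant \<Longrightarrow> 0 \<le> vsum y"
  by (auto simp: orthant_def intro: sum_nonneg)

lemma ex_frontier_RS_below:
  assumes "y \<in> RS x n" "i \<in> {1..n}" "vless 0 (x i)"
  shows "\<exists>z\<in>frontier_RS x n. vsum z \<le> vsum y"
proof -
  have y: "y \<in> orthant" using assms(1) RS_subset_orthant by blast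
  have sub: "closed_segment 0 y \<subseteq> orthant"
    using y by (intro closed_segment_subset convex_orthant) (auto simp: orthant_def)
  \<comment> \<open>The positive observation \<open>x i\<close> dominates the origin, so the segment
    starts outside \<open>RS x n\<close> and ends inside it.\<close>
  have "0 \<in> closed_segment 0 y - RS x n"
    using assms by (auto simp: RS_def)
  hence "closed_segment 0 y \<inter> frontier_RS x n \<noteq> {}"
    unfolding frontier_RS_def
    using assms(1) sub
    by (intro connectedin_Int_frontier_of) (auto simp: connectedin_subtopology)
  then obtain t where t: "0 \<le> t" "t \<le> 1" "t *\<^sub>R y \<in> frontier_RS x n"
    by (auto simp: in_segment)
  have "vsum (t *\<^sub>R y) = t * vsum y" by (simp add: sum_distrib_left)
  also have "\<dots> \<le> 1 * vsum y"
    using t vsum_nonneg[OF y] by (intro mult_right_mono) auto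
  finally show ?thesis using t(3) by (intro bexI[of _ "t *\<^sub>R y"]) simp_all
qed

lemma bdd_below_frontier_RS: "bdd_below (vsum ` frontier_RS x n)"
  using frontier_RS_subset RS_subset_orthant vsum_nonneg by (intro bdd_belowI2[of _ 0]) blast

lemma RS_nonempty: "RS x n \<noteq> {}"
proof -
  define y where "y = (\<chi> j. \<Sum>i=1..n. \<bar>x i $ j\<bar>)"
  have "x i $ j \<le> y $ j" if "i \<in> {1..n}" for i j
    using member_le_sum[of i "{1..n}" "\<lambda>i. \<bar>x i $ j\<bar>"] that by (simp add: y_def)
  hence "y \<in> RS x n"
    by (auto simp: RS_def orthant_def vless_def not_less) (auto simp: y_def intro!: sum_nonneg)
  thus ?thesis by blast
qed

lemma Fmin_le:
  assumes "y \<in> RS x n" "i \<in> {1..n}" "vless 0 (x i)"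
  shows "Fmin x n \<le> vsum y"
proof -
  obtain z where "z \<in> frontier_RS x n" "vsum z \<le> vsum y"
    using ex_frontier_RS_below[OF assms] by blast
  thus ?thesis
    unfolding Fmin_def by (intro order_trans[OF cINF_lower[OF bdd_below_frontier_RS]])
qed

text \<open>The frontier lies in \<open>RS x n\<close>, and below every point of
  \<open>RS x n\<close> there is a frontier point with no larger sum. The strict inequality lets a
  witness be extracted without attainment of the infimum.\<close>

lemma Fmin_less_iff:
  assumes "i \<in> {1..n}" "vless 0 (x i)"
  shows "Fmin x n < a \<longleftrightarrow> (\<exists>y\<in>RS x n. vsum y < a)"
proof
  assume "Fmin x n < a"
  moreover have "frontier_RS x n \<noteq> {}"
    using RS_nonempty[of x n] ex_frontier_RS_below assms by blast
  ultimately show "\<exists>y\<in>RS x n. vsum y < a"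
    unfolding Fmin_def using frontier_RS_subset
    by (subst (asm) cINF_less_iff[OF _ bdd_below_frontier_RS]) auto
next
  assume "\<exists>y\<in>RS x n. vsum y < a"
  thus "Fmin x n < a" using Fmin_le assms le_less_trans by blast
qed

text \<open>If no observation is positive, no point of the orthant is dominated, so
  \<open>RS x n\<close> is the whole space of the subtopology and has empty frontier. The default
  value \<open>Inf {}\<close> is a constant, which is all that measurability requires.\<close>

lemma Fmin_degenerate:
  assumes "\<And>i. i \<in> {1..n} \<Longrightarrow> \<not> vless 0 (x i)"
  shows "Fmin x n = Inf {}"
proof -
  have "\<not> vless y (x i)" if "y \<in> orthant" "i \<in> {1..n}" for i y
  proof
    assume "vless y (x i)"
    hence "0 < x i $ j" for j
      using that(1) le_less_trans[of 0 "y $ j" "x i $ j"] by (simp add: vless_def orthant_def)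
    thus False using assms[OF that(2)] by (simp add: vless_def)
  qed
  hence "RS x n = topspace (subtopology euclidean orthant)"
    by (auto simp: RS_def)
  hence "frontier_RS x n = {}"
    unfolding frontier_RS_def by (simp only: frontier_of_topspace)
  thus ?thesis by (simp add: Fmin_def)
qed

text \<open>Upward closedness allows each coordinate to be pushed up to a nearby rational without
  leaving \<open>RS x n\<close>. The existential then ranges over a countable set, as needed for
  measurability of \<open>Fmin\<close>.\<close>

lemma Fmin_less_iff_rational:
  assumes "i \<in> {1..n}" "vless 0 (x i)"
  shows "Fmin x n < a \<longleftrightarrow> (\<exists>y\<in>{y. \<forall>j. y $ j \<in> \<rat>}. y \<in> RS x n \<and> vsum y < a)"
proof
  assume "Fmin x n < a"
  then obtain y where y: "y \<in> RS x n" "vsum y < a" using Fmin_less_iff assms by blast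
  \<comment> \<open>The slack below \<open>a\<close> is shared equally among the
    coordinates.\<close>
  define e where "e = (a - vsum y) / CARD('a)"
  have e: "e > 0" using y by (simp add: e_def)
  have "\<exists>q\<in>\<rat>. y $ j < q \<and> q < y $ j + e" for j
    using Rats_dense_in_real[of "y $ j" "y $ j + e"] e by auto
  then obtain q where q: "\<And>j. q j \<in> \<rat>" "\<And>j. y $ j < q j" "\<And>j. q j < y $ j + e"
    by metis
  have "vsum (vec_lambda q) < (\<Sum>j\<in>UNIV. y $ j + e)"
    using q(3) by (simp add: sum_strict_mono)
  also have "\<dots> = a" by (simp add: sum.distrib e_def)
  finally have "vsum (vec_lambda q) < a" .
  moreover have "vec_lambda q \<in> RS x n"
    using q(2) by (intro RS_upward_closed[OF y(1)]) (simp add: less_imp_le)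
  ultimately show "\<exists>y\<in>{y. \<forall>j. y $ j \<in> \<rat>}. y \<in> RS x n \<and> vsum y < a"
    using q(1) by (intro bexI[of _ "vec_lambda q"]) auto
next
  assume "\<exists>y\<in>{y. \<forall>j. y $ j \<in> \<rat>}. y \<in> RS x n \<and> vsum y < a"
  thus "Fmin x n < a" using Fmin_less_iff assms by blast
qed

lemma countable_rational_vectors: "countable {y :: real^'d::finite. \<forall>j. y $ j \<in> \<rat>}"
proof -
  have "{y :: real^'d. \<forall>j. y $ j \<in> \<rat>} = vec_lambda ` (PiE UNIV (\<lambda>_. \<rat>))"
  proof -
    have "y \<in> vec_lambda ` (PiE UNIV (\<lambda>_. \<rat>))" if "\<forall>j. y $ j \<in> \<rat>" for y :: "real^'d"
      using that by (intro image_eqI[of _ _ "vec_nth y"]) (auto simp: vec_nth_inverse)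
    thus ?thesis by auto
  qed
  moreover have "countable (PiE (UNIV :: 'd set) (\<lambda>_. \<rat> :: real set))"
    by (intro countable_PiE) (auto simp: countable_rat)
  ultimately show ?thesis by simp
qed

text \<open>The point at height \<open>u\<close> on the \<open>j\<close>-th axis is dominated by no
  observation, because its \<open>j\<close>-th coordinate is already too large.\<close>

lemma Fmin_le_of_coord_le:
  assumes "u \<ge> 0" "\<And>i. i \<in> {1..n} \<Longrightarrow> x i $ j \<le> u" "n \<ge> 1" "vless 0 (x 1)"
  shows "Fmin x n \<le> u"
proof -
  have "vsum (axis j u) = u" by (simp add: axis_def)
  moreover have "axis j u \<in> RS x n"
    using assms(1,2) by (auto simp: RS_def orthant_def vless_def axis_def not_less intro!: exI[of _ j])
  ultimately show ?thesis using Fmin_le[of "axis j u" x n 1] assms(3,4) by simp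
qed

subsection \<open>Borel--Cantelli lemmas\<close>

text \<open>Independence bounds the probability of no success in \<open>{K..N}\<close> by the
  product of \<open>1 - p n\<close>, hence by \<open>exp\<close> of minus the partial sum of
  \<open>p\<close>.\<close>

lemma (in prob_space) borel_cantelli_AE2:
  fixes P :: "nat \<Rightarrow> 'a \<Rightarrow> bool"
  assumes indep: "indep_vars (\<lambda>_. count_space UNIV) P UNIV"
    and div: "\<not> summable (\<lambda>n. prob {\<omega> \<in> space M. P n \<omega>})"
  shows "AE \<omega> in M. \<exists>\<^sub>F n in sequentially. P n \<omega>"
proof -
  define p where "p n = prob {\<omega> \<in> space M. P n \<omega>}" for n
  have [measurable]: "P n \<in> measurable M (count_space UNIV)" for n
    using indep by (auto simp: indep_vars_def)
  have fail: "prob {\<omega> \<in> space M. \<forall>n\<ge>K. \<not> P n \<omega>} = 0" for K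
  proof -
    have bound: "prob {\<omega> \<in> space M. \<forall>n\<ge>K. \<not> P n \<omega>} \<le> exp (- (\<Sum>n=K..N. p n))" if "N \<ge> K" for N
    proof -
      have "prob {\<omega> \<in> space M. \<forall>n\<ge>K. \<not> P n \<omega>}
          \<le> prob (\<Inter>n\<in>{K..N}. P n -` {False} \<inter> space M)"
      proof (rule finite_measure_mono)
        show "(\<Inter>n\<in>{K..N}. P n -` {False} \<inter> space M) \<in> events"
          using that by (intro sets.finite_INT measurable_sets[of _ _ "count_space UNIV"]) auto
        show "{\<omega> \<in> space M. \<forall>n\<ge>K. \<not> P n \<omega>} \<subseteq> (\<Inter>n\<in>{K..N}. P n -` {False} \<inter> space M)"
        proof (intro subsetI INT_I)
          fix \<omega> n assume "\<omega> \<in> {\<omega> \<in> space M. \<forall>n\<ge>K. \<not> P n \<omega>}" "n \<in> {K..N}"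
          thus "\<omega> \<in> P n -` {False} \<inter> space M" by simp
        qed
      qed
      also have "\<dots> = (\<Prod>n=K..N. prob (P n -` {False} \<inter> space M))"
        using that by (intro indep_varsD[OF indep]) auto
      also have "\<dots> = (\<Prod>n=K..N. 1 - p n)"
      proof (intro prod.cong refl)
        fix n
        have "P n -` {False} \<inter> space M = space M - {\<omega> \<in> space M. P n \<omega>}" by auto
        thus "prob (P n -` {False} \<inter> space M) = 1 - p n"
          by (simp add: p_def prob_compl)
      qed
      also have "\<dots> \<le> (\<Prod>n=K..N. exp (- p n))"
        by (intro prod_mono conjI) (use exp_ge_add_one_self[of "- p _"] in \<open>auto simp: p_def\<close>)
      also have "\<dots> = exp (- (\<Sum>n=K..N. p n))"
        by (simp add: exp_sum sum_negf[symmetric])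
      finally show ?thesis .
    qed
    show ?thesis
    proof (rule ccontr)
      assume "prob {\<omega> \<in> space M. \<forall>n\<ge>K. \<not> P n \<omega>} \<noteq> 0"
      hence pos: "prob {\<omega> \<in> space M. \<forall>n\<ge>K. \<not> P n \<omega>} > 0" (is "?q > 0")
        by (simp add: zero_less_measure_iff)
      \<comment> \<open>A positive probability \<open>?q\<close> of no success from \<open>K\<close>
        on would bound all partial sums by \<open>- ln ?q\<close>.\<close>
      have "summable (\<lambda>n. p (n + K))"
      proof (rule bounded_imp_summable)
        show "p (n + K) \<ge> 0" for n by (simp add: p_def)
        fix N
        have "?q \<le> exp (- (\<Sum>n=K..N+K. p n))" by (intro bound) simp
        hence "ln ?q \<le> - (\<Sum>n=K..N+K. p n)" using pos ln_le_cancel_iff[OF pos exp_gt_zero] by simp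
        moreover have "(\<Sum>n=K..N+K. p n) = (\<Sum>n\<le>N. p (n + K))"
          using sum.shift_bounds_cl_nat_ivl[of p 0 K N] by (simp add: atMost_atLeast0)
        ultimately show "(\<Sum>n\<le>N. p (n + K)) \<le> - ln ?q" by simp
      qed
      thus False using div by (subst (asm) summable_iff_shift) (simp add: p_def[abs_def])
    qed
  qed
  have "AE \<omega> in M. \<forall>K. \<not> (\<forall>n\<ge>K. \<not> P n \<omega>)"
    unfolding AE_all_countable
  proof
    fix K
    show "AE \<omega> in M. \<not> (\<forall>n\<ge>K. \<not> P n \<omega>)"
      using fail[of K] by (subst (asm) prob_eq_0) auto
  qed
  thus ?thesis by (simp add: frequently_sequentially)
qed

text \<open>Dominated convergence for the indicators. This turns an almost sure statement into
  convergence in probability.\<close>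

lemma (in prob_space) prob_tendsto_0_of_AE_eventually_not:
  assumes [measurable]: "\<And>n. {\<omega> \<in> space M. P n \<omega>} \<in> events"
    and "AE \<omega> in M. \<forall>\<^sub>F n in sequentially. \<not> P n \<omega>"
  shows "(\<lambda>n. prob {\<omega> \<in> space M. P n \<omega>}) \<longlonglongrightarrow> 0"
proof -
  have "(\<lambda>n. \<integral>\<omega>. indicator {\<omega> \<in> space M. P n \<omega>} \<omega> \<partial>M) \<longlonglongrightarrow> (\<integral>\<omega>. 0 \<partial>M :: real)"
  proof (rule integral_dominated_convergence[where w="\<lambda>_. 1"])
    show "AE \<omega> in M. (\<lambda>n. indicator {\<omega> \<in> space M. P n \<omega>} \<omega> :: real) \<longlonglongrightarrow> 0"
      using assms(2)
    proof eventually_elim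
      case (elim \<omega>)
      thus ?case
        by (intro tendsto_eventually) (auto elim!: eventually_mono)
    qed
  qed (auto simp: indicator_def)
  thus ?thesis by simp
qed

lemma filterlim_floor_log: "filterlim floor_log at_top sequentially"
  unfolding filterlim_at_top eventually_sequentially
proof
  fix K :: nat
  show "\<exists>N. \<forall>n\<ge>N. K \<le> floor_log n"
    using floor_log_le_iff[of "2 ^ K"] by (intro exI[of _ "2 ^ K"]) simp
qed

text \<open>The first Borel-Cantelli lemma excludes \<open>E k\<close> for all large
  \<open>k\<close>. Each positive \<open>n\<close> lies in the block with
  \<open>k = floor_log n\<close>, which tends to infinity, so one event per block controls all
  \<open>n\<close>.\<close>

lemma (in prob_space) AE_eventually_not_of_dyadic:
  assumes events: "\<And>k. E k \<in> events" and sum: "summable (\<lambda>k. prob (E k))"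
    and cover: "AE \<omega> in M. \<forall>\<^sub>F k in sequentially. \<forall>n\<in>{2^k..<2^Suc k}. P n \<omega> \<longrightarrow> \<omega> \<in> E k"
  shows "AE \<omega> in M. \<forall>\<^sub>F n in sequentially. \<not> P n \<omega>"
proof -
  have "AE \<omega> in M. \<forall>\<^sub>F k in sequentially. \<omega> \<in> space M - E k"
    using events sum by (intro borel_cantelli_AE1) (auto simp: emeasure_eq_measure)
  with cover show ?thesis
  proof eventually_elim
    case (elim \<omega>)
    hence "\<forall>\<^sub>F k in sequentially. \<forall>n\<in>{2^k..<2^Suc k}. \<not> P n \<omega>"
      by eventually_elim auto
    hence "\<forall>\<^sub>F n in sequentially. \<forall>m\<in>{2^floor_log n..<2^Suc (floor_log n)}. \<not> P m \<omega>"
      using filterlim_floor_log by (rule eventually_compose_filterlim)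
    with eventually_gt_at_top[of 0] show ?case
    proof eventually_elim
      case (elim n)
      thus ?case using floor_log_exp2_le[of n] floor_log_exp2_gt[of n] by auto
    qed
  qed
qed

subsection \<open>Asymptotic estimates\<close>

text \<open>Cauchy condensation: the condensed terms are at least \<open>1 / (2 * (n + 1))\<close>,
  half the harmonic series.\<close>

lemma not_summable_inverse_mult_ln:
  "\<not> summable (\<lambda>k. 1 / (real (Suc k) * ln (real (Suc k))))"
proof
  let ?f = "\<lambda>k. 1 / (real (Suc k) * ln (real (Suc k)))"
  assume "summable ?f"
  \<comment> \<open>At index 0 the denominator contains \<open>ln 1 = 0\<close>, so
    \<open>?f 0 = 0\<close> and the decrease only starts at index 1.\<close>
  moreover have "?f (Suc m) \<le> ?f m" if "0 < m" for m
    using that by (intro divide_left_mono mult_mono mult_pos_pos) auto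
  ultimately have "summable (\<lambda>n. 2 ^ n * ?f (2 ^ n))"
    by (subst (asm) condensation_test) auto
  moreover have "norm (inverse (real (Suc n)) / 2) \<le> 2 ^ n * ?f (2 ^ n)" for n
  proof -
    have "ln (real (Suc (2 ^ n))) \<le> ln (2 ^ Suc n)"
      by (subst ln_le_cancel_iff) (auto simp: add_pos_nonneg)
    also have "\<dots> = real (Suc n) * ln 2" by (subst ln_realpow) auto
    also have "\<dots> \<le> real (Suc n) * 1"
      using ln_2_less_1 by (intro mult_left_mono) auto
    finally have "ln (real (Suc (2 ^ n))) \<le> real (Suc n)" by simp
    moreover have "real (Suc (2 ^ n)) \<le> 2 * 2 ^ n" by simp
    ultimately have "real (Suc (2 ^ n)) * ln (real (Suc (2 ^ n))) \<le> (2 * 2 ^ n) * real (Suc n)"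
      by (intro mult_mono) auto
    hence "2 ^ n / ((2 * 2 ^ n) * real (Suc n)) \<le>
        2 ^ n / (real (Suc (2 ^ n)) * ln (real (Suc (2 ^ n))))"
      by (intro divide_left_mono mult_pos_pos) (auto simp: add_pos_nonneg)
    moreover have "2 ^ n / ((2 * 2 ^ n) * real (Suc n)) = norm (inverse (real (Suc n)) / 2)"
      by (simp add: divide_simps)
    ultimately show ?thesis by (simp only: times_divide_eq_right mult_1_right)
  qed
  ultimately have "summable (\<lambda>n. inverse (real (Suc n)) / 2)"
    by (rule summable_comparison_test'[where N=0])
  hence "summable (\<lambda>n. inverse (real (Suc n)))"
    by (simp add: summable_divide_iff)
  thus False
    using not_summable_harmonic[where 'a=real] summable_Suc_iff[of "\<lambda>n. inverse (real n)"] by simp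
qed

text \<open>With \<open>q = ln (ln n) / n\<close>, use
  \<open>ln (1 - q) \<ge> - q - 2 * q^2\<close>. The quadratic part, multiplied by \<open>n\<close>,
  is eventually at most 1 and accounts for the factor \<open>exp (-1)\<close>.\<close>

lemma eventually_one_minus_lnln_power_ge:
  "\<forall>\<^sub>F n::nat in sequentially. (1 - ln (ln n) / n) ^ n \<ge> exp (-1) / ln n"
proof -
  have "\<forall>\<^sub>F n::nat in sequentially. 0 \<le> ln (ln n) / n" by real_asymp
  moreover have "\<forall>\<^sub>F n::nat in sequentially. ln (ln n) / n \<le> 1 / 2" by real_asymp
  moreover have "\<forall>\<^sub>F n::nat in sequentially. 2 * (ln (ln n))\<^sup>2 / n \<le> 1" by real_asymp
  moreover have "\<forall>\<^sub>F n::nat in sequentially. ln n > 0" by real_asymp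
  moreover have "\<forall>\<^sub>F n::nat in sequentially. n > 0" by (rule eventually_gt_at_top)
  ultimately show ?thesis
  proof eventually_elim
    case (elim n)
    define q where "q = ln (ln n) / n"
    have q: "0 \<le> q" "q \<le> 1 / 2" using elim by (auto simp: q_def)
    have "exp (-1) / ln n = exp (- ln (ln n) - 1)" using elim by (simp add: exp_diff exp_minus field_simps)
    also have "\<dots> \<le> exp (- ln (ln n) - 2 * (ln (ln n))\<^sup>2 / n)" using elim by simp
    also have "\<dots> = exp (real n * (- q - 2 * q\<^sup>2))"
      using elim by (simp add: q_def field_simps power2_eq_square)
    also have "\<dots> = exp (- q - 2 * q\<^sup>2) ^ n" by (simp add: exp_of_nat_mult)
    also have "\<dots> \<le> (1 - q) ^ n"
    proof (rule power_mono)
      have "- q - 2 * q\<^sup>2 \<le> ln (1 - q)" using q by (rule ln_one_minus_pos_lower_bound)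
      thus "exp (- q - 2 * q\<^sup>2) \<le> 1 - q" using q by (simp add: ln_ge_iff)
    qed simp
    finally show ?case by (simp add: q_def)
  qed
qed

text \<open>The numerator is \<open>ln (ln m)\<close> for \<open>m = Suc k ^ (2 * Suc k)\<close>,
  the subsequence used for the infinitely often statement.\<close>

lemma summable_lnln_div_square:
  "summable (\<lambda>k. ln (2 * real (Suc k) * ln (real (Suc k))) / real (Suc k) ^ 2)"
proof (rule summable_comparison_test_bigo)
  show "summable (\<lambda>k. norm (real k powr (-3/2)))" by (simp add: summable_real_powr_iff)
  show "(\<lambda>k. ln (2 * real (Suc k) * ln (real (Suc k))) / real (Suc k) ^ 2) \<in> O(\<lambda>k. real k powr (-3/2))"
    by real_asymp
qed

lemma summable_grid_bound:
  fixes C :: real and d :: nat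
  assumes "C > 0"
  shows "summable (\<lambda>k. real (k + 3) ^ d * exp (- (C * ln (k * ln 2) ^ 3)))"
proof (rule summable_comparison_test_bigo)
  show "summable (\<lambda>k. norm (real k powr (-2)))" by (simp add: summable_real_powr_iff)
  show "(\<lambda>k. real (k + 3) ^ d * exp (- (C * ln (k * ln 2) ^ 3))) \<in> O(\<lambda>k. real k powr (-2))"
    using assms by real_asymp
qed

subsection \<open>Vectors with independent exponential coordinates\<close>

lemma borel_measurable_vec_iff:
  fixes f :: "'a \<Rightarrow> real^'d::finite"
  shows "f \<in> borel_measurable M \<longleftrightarrow> (\<forall>j. (\<lambda>x. f x $ j) \<in> borel_measurable M)"
  unfolding borel_measurable_euclidean_space[of f]
  by (auto simp: Basis_vec_def inner_axis)

lemma open_Collect_vless: "open {z. vless y z}"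
proof -
  have "{z. vless y z} = (\<Inter>j. {z. y $ j < z $ j})" by (auto simp: vless_def)
  also have "open \<dots>" by (intro open_INT finite ballI open_Collect_less continuous_intros)
  finally show ?thesis .
qed

text \<open>Independence is imposed on all real coordinates at once, indexed by pairs; this encodes
  independence between the vectors as well as within each one. Indices start at 1.\<close>

locale iid_exponential_vectors = prob_space M for M :: "'m measure" +
  fixes X :: "nat \<Rightarrow> 'm \<Rightarrow> real^'d::finite"
  assumes indep: "indep_vars (\<lambda>_. borel) (\<lambda>(i, j) \<omega>. X i \<omega> $ j) ({1..} \<times> UNIV)"
    and expo: "\<And>i j. i \<ge> 1 \<Longrightarrow> distributed M lborel (\<lambda>\<omega>. X i \<omega> $ j) (exponential_density 1)"
begin

lemma measurable_X: "i \<ge> 1 \<Longrightarrow> X i \<in> borel_measurable M"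
  using distributed_measurable[OF expo] by (auto simp: borel_measurable_vec_iff)

text \<open>Group the pairs by their first component and reassemble each group into a vector by a
  measurable map.\<close>

lemma indep_X: "indep_vars (\<lambda>_. borel) X {1..}"
proof -
  have "indep_vars (\<lambda>i. PiM ({i} \<times> UNIV) (\<lambda>_. borel))
      (\<lambda>i \<omega>. restrict (\<lambda>p. (\<lambda>(i, j) \<omega>. X i \<omega> $ j) p \<omega>) ({i} \<times> UNIV)) {1..}"
    by (intro indep_vars_restrict[OF indep]) (auto simp: disjoint_family_on_def)
  hence "indep_vars (\<lambda>_. borel)
      (\<lambda>i \<omega>. (\<lambda>f. \<chi> j. f (i, j)) (restrict (\<lambda>p. (\<lambda>(i, j) \<omega>. X i \<omega> $ j) p \<omega>) ({i} \<times> UNIV))) {1..}"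
    by (rule indep_vars_compose2)
       (auto simp: borel_measurable_vec_iff intro!: measurable_component_singleton)
  thus ?thesis by (simp add: restrict_def vec_nth_inverse cong: indep_vars_cong)
qed

lemma events_vless [measurable]: "i \<ge> 1 \<Longrightarrow> {\<omega> \<in> space M. vless y (X i \<omega>)} \<in> events"
  using measurable_sets[OF measurable_X borel_open[OF open_Collect_vless], of i y]
  by (simp add: vimage_def Int_def conj_commute)

lemma prob_vless:
  assumes "i \<ge> 1" "y \<in> orthant"
  shows "prob {\<omega> \<in> space M. vless y (X i \<omega>)} = exp (- vsum y)"
proof -
  let ?X = "\<lambda>(i, j) \<omega>. X i \<omega> $ j"
  have "{\<omega> \<in> space M. vless y (X i \<omega>)} = (\<Inter>p\<in>{i} \<times> UNIV. ?X p -` {y $ snd p<..} \<inter> space M)"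
    by (auto simp: vless_def)
  also have "prob \<dots> = (\<Prod>p\<in>{i} \<times> UNIV. prob (?X p -` {y $ snd p<..} \<inter> space M))"
    using assms by (intro indep_varsD[OF indep]) auto
  also have "\<dots> = (\<Prod>j\<in>UNIV. \<P>(\<omega> in M. y $ j < X i \<omega> $ j))"
    by (intro prod.reindex_bij_witness[of _ "\<lambda>j. (i, j)" snd])
       (auto intro!: arg_cong[where f=prob])
  also have "\<dots> = (\<Prod>j\<in>UNIV. exp (- y $ j))"
    using assms exponential_distributedD_gt[OF expo] by (intro prod.cong) (auto simp: orthant_def)
  also have "\<dots> = exp (- vsum y)" by (simp add: exp_sum sum_negf[symmetric])
  finally show ?thesis .
qed

lemma events_RS [measurable]: "{\<omega> \<in> space M. y \<in> RS (\<lambda>i. X i \<omega>) n} \<in> events"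
proof -
  have "{\<omega> \<in> space M. y \<in> RS (\<lambda>i. X i \<omega>) n} =
      {\<omega> \<in> space M. y \<in> orthant \<and> (\<forall>i\<in>{1..n}. \<not> vless y (X i \<omega>))}"
    by (auto simp: RS_def)
  also have "\<dots> \<in> events" by measurable
  finally show ?thesis .
qed

lemma prob_not_vless:
  assumes "i \<ge> 1" "y \<in> orthant"
  shows "prob {\<omega> \<in> space M. \<not> vless y (X i \<omega>)} = 1 - exp (- vsum y)"
  using prob_neg[OF events_vless[OF assms(1), of y]] prob_vless[OF assms] by simp

lemma prob_RS:
  assumes "y \<in> orthant"
  shows "prob {\<omega> \<in> space M. y \<in> RS (\<lambda>i. X i \<omega>) n} = (1 - exp (- vsum y)) ^ n"
proof (cases "n = 0")
  case True
  thus ?thesis using assms by (simp add: RS_def prob_space)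
next
  case False
  have meas: "- {z. vless y z} \<in> sets borel"
    using open_Collect_vless[of y] by (intro borel_closed) (simp add: closed_def)
  have "{\<omega> \<in> space M. y \<in> RS (\<lambda>i. X i \<omega>) n} =
      (\<Inter>i\<in>{1..n}. X i -` (- {z. vless y z}) \<inter> space M)"
    using assms False by (auto simp: RS_def)
  also have "prob \<dots> = (\<Prod>i=1..n. prob (X i -` (- {z. vless y z}) \<inter> space M))"
    using False meas by (intro indep_varsD[OF indep_X]) auto
  also have "\<dots> = (\<Prod>i=1..n. 1 - exp (- vsum y))"
  proof (intro prod.cong refl)
    fix i assume i: "i \<in> {1..n}"
    have "X i -` (- {z. vless y z}) \<inter> space M = {\<omega> \<in> space M. \<not> vless y (X i \<omega>)}" by auto
    thus "prob (X i -` (- {z. vless y z}) \<inter> space M) = 1 - exp (- vsum y)"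
      using prob_not_vless assms i by simp
  qed
  finally show ?thesis by simp
qed

lemma prob_RS_le:
  assumes "y \<in> orthant"
  shows "prob {\<omega> \<in> space M. y \<in> RS (\<lambda>i. X i \<omega>) n} \<le> exp (- (real n * exp (- vsum y)))"
proof -
  have "(1 - exp (- vsum y)) ^ n \<le> exp (- exp (- vsum y)) ^ n"
    using vsum_nonneg[OF assms] exp_ge_add_one_self[of "- exp (- vsum y)"]
    by (intro power_mono) auto
  thus ?thesis by (simp add: prob_RS[OF assms] exp_of_nat_mult[symmetric])
qed

lemma prob_all_vless:
  fixes L :: nat
  assumes "inj_on f {..<L}" "\<And>a. a < L \<Longrightarrow> f a \<ge> 1" "\<And>a. a < L \<Longrightarrow> z a \<in> orthant"
  shows "prob {\<omega> \<in> space M. \<forall>a<L. vless (z a) (X (f a) \<omega>)} = (\<Prod>a<L. exp (- vsum (z a)))"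
proof (cases "L = 0")
  case True
  thus ?thesis by (simp add: prob_space)
next
  case False
  \<comment> \<open>Independence is indexed by observations, so the intersection over
    \<open>a\<close> is rewritten over the indices \<open>f a\<close>; \<open>g\<close> recovers the
    point assigned to each.\<close>
  define g where "g = the_inv_into {..<L} f"
  have g: "g (f a) = a" if "a < L" for a
    using the_inv_into_f_f[OF assms(1)] that by (simp add: g_def)
  have "{\<omega> \<in> space M. \<forall>a<L. vless (z a) (X (f a) \<omega>)} =
      (\<Inter>i\<in>f ` {..<L}. X i -` {w. vless (z (g i)) w} \<inter> space M)"
    using False by (auto simp: g)
  also have "prob \<dots> = (\<Prod>i\<in>f ` {..<L}. prob (X i -` {w. vless (z (g i)) w} \<inter> space M))"
    using False borel_open[OF open_Collect_vless] assms(2) by (intro indep_varsD[OF indep_X]) auto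
  also have "\<dots> = (\<Prod>a<L. prob {\<omega> \<in> space M. vless (z a) (X (f a) \<omega>)})"
    by (subst prod.reindex[OF assms(1)])
       (auto simp: g intro!: prod.cong arg_cong[where f=prob])
  also have "\<dots> = (\<Prod>a<L. exp (- vsum (z a)))"
    using assms by (intro prod.cong refl prob_vless) auto
  finally show ?thesis .
qed

lemma AE_positive: "AE \<omega> in M. \<forall>i\<ge>1. vless 0 (X i \<omega>)"
proof -
  have "AE \<omega> in M. i \<ge> 1 \<longrightarrow> vless 0 (X i \<omega>)" for i
  proof (cases "i \<ge> 1")
    case True
    have "prob {\<omega> \<in> space M. vless 0 (X i \<omega>)} = 1"
      using prob_vless[OF True, of 0] by (simp add: orthant_def)
    thus ?thesis using events_vless[OF True] by (subst (asm) prob_eq_1) auto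
  qed auto
  thus ?thesis by (simp add: AE_all_countable)
qed

text \<open>Split by whether some observation is positive: one case is a countable union over
  rational points, the other a constant.\<close>

lemma borel_measurable_Fmin [measurable]:
  "(\<lambda>\<omega>. Fmin (\<lambda>i. X i \<omega>) n) \<in> borel_measurable M"
proof (subst borel_measurable_iff_less, intro allI)
  fix a :: real
  let ?Q = "{y :: real^'d. \<forall>j. y $ j \<in> \<rat>}"
  have "{\<omega> \<in> space M. Fmin (\<lambda>i. X i \<omega>) n < a} =
      {\<omega> \<in> space M. if \<exists>i\<in>{1..n}. vless 0 (X i \<omega>)
        then \<exists>y\<in>?Q. y \<in> RS (\<lambda>i. X i \<omega>) n \<and> vsum y < a else Inf {} < a}"
  proof (intro Collect_cong conj_cong refl)
    fix \<omega>
    show "Fmin (\<lambda>i. X i \<omega>) n < a \<longleftrightarrow> (if \<exists>i\<in>{1..n}. vless 0 (X i \<omega>)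
        then \<exists>y\<in>?Q. y \<in> RS (\<lambda>i. X i \<omega>) n \<and> vsum y < a else Inf {} < a)"
    proof (cases "\<exists>i\<in>{1..n}. vless 0 (X i \<omega>)")
      case True
      then obtain i where "i \<in> {1..n}" "vless 0 (X i \<omega>)" by blast
      with Fmin_less_iff_rational[where x="\<lambda>i. X i \<omega>" and i=i] True show ?thesis by simp
    next
      case False
      with Fmin_degenerate[of n "\<lambda>i. X i \<omega>"] show ?thesis by simp
    qed
  qed
  also have "\<dots> \<in> events"
    using countable_rational_vectors by measurable auto
  finally show "{\<omega> \<in> space M. Fmin (\<lambda>i. X i \<omega>) n < a} \<in> events" .
qed

section \<open>Extremes of a single coordinate\<close>

lemma prob_coord_all_le:
  assumes "finite B" "B \<subseteq> {1..}" "u \<ge> 0"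
  shows "prob {\<omega> \<in> space M. \<forall>i\<in>B. X i \<omega> $ j \<le> u} = (1 - exp (- u)) ^ card B"
proof (cases "B = {}")
  case True
  thus ?thesis by (simp add: prob_space)
next
  case False
  let ?X = "\<lambda>(i, j) \<omega>. X i \<omega> $ j"
  have "{\<omega> \<in> space M. \<forall>i\<in>B. X i \<omega> $ j \<le> u} = (\<Inter>p\<in>B \<times> {j}. ?X p -` {..u} \<inter> space M)"
    using False by auto
  also have "prob \<dots> = (\<Prod>p\<in>B \<times> {j}. prob (?X p -` {..u} \<inter> space M))"
    using assms False by (intro indep_varsD[OF indep]) auto
  also have "\<dots> = (\<Prod>i\<in>B. \<P>(\<omega> in M. X i \<omega> $ j \<le> u))"
    by (intro prod.reindex_bij_witness[of _ "\<lambda>i. (i, j)" fst])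
       (auto intro!: arg_cong[where f=prob])
  also have "\<dots> = (\<Prod>i\<in>B. 1 - exp (- u))"
    using assms exponential_distributedD_le[OF expo] by (intro prod.cong) auto
  finally show ?thesis by simp
qed

text \<open>Functions of disjoint groups of independent vectors are independent. The variables are
  Boolean valued to match the form of \<open>borel_cantelli_AE2\<close>.\<close>

lemma indep_coord_blocks:
  assumes "\<And>k::nat. finite (B k)" "\<And>k. B k \<subseteq> {1..}" "disjoint_family B"
  shows "indep_vars (\<lambda>_. count_space UNIV) (\<lambda>k \<omega>. \<forall>i\<in>B k. X i \<omega> $ j \<le> u k) UNIV"
proof -
  have "indep_vars (\<lambda>k. PiM (B k) (\<lambda>_. borel)) (\<lambda>k \<omega>. restrict (\<lambda>i. X i \<omega>) (B k)) UNIV"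
    using assms by (intro indep_vars_restrict[OF indep_X]) auto
  hence "indep_vars (\<lambda>_. count_space UNIV)
      (\<lambda>k \<omega>. (\<lambda>f. \<forall>i\<in>B k. f i $ j \<le> u k) (restrict (\<lambda>i. X i \<omega>) (B k))) UNIV"
  proof (rule indep_vars_compose2)
    fix k
    have [measurable]: "(\<lambda>f. f i $ j :: real) \<in> borel_measurable (PiM (B k) (\<lambda>_. borel))" if "i \<in> B k" for i
      using measurable_component_singleton[OF that, of "\<lambda>_. borel :: (real^'d) measure"]
      by (subst (asm) borel_measurable_vec_iff) auto
    show "(\<lambda>f. \<forall>i\<in>B k. f i $ j \<le> u k) \<in> measurable (PiM (B k) (\<lambda>_. borel)) (count_space UNIV)"
      using assms(1)[of k] by measurable
  qed
  thus ?thesis by simp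
qed

lemma events_coord_gt [measurable]: "i \<ge> 1 \<Longrightarrow> {\<omega> \<in> space M. u < X i \<omega> $ j} \<in> events"
  using measurable_X[of i] by (auto simp: borel_measurable_vec_iff borel_measurable_iff_greater)

lemma prob_ex_coord_gt:
  assumes "u \<ge> 0"
  shows "prob {\<omega> \<in> space M. \<exists>i\<in>{1..n}. u < X i \<omega> $ j} \<le> real n * exp (- u)"
proof -
  have "{\<omega> \<in> space M. \<exists>i\<in>{1..n}. u < X i \<omega> $ j} = (\<Union>i\<in>{1..n}. {\<omega> \<in> space M. u < X i \<omega> $ j})"
    by auto
  also have "prob \<dots> \<le> (\<Sum>i=1..n. prob {\<omega> \<in> space M. u < X i \<omega> $ j})"
    by (intro finite_measure_subadditive_finite) auto
  also have "\<dots> = (\<Sum>i=1..n. exp (- u))"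
    using exponential_distributedD_gt[OF expo assms] by (intro sum.cong) auto
  finally show ?thesis by simp
qed

lemma events_ex_coord_gt [measurable]: "{\<omega> \<in> space M. \<exists>i\<in>{1..n}. u < X i \<omega> $ j} \<in> events"
  by measurable

text \<open>A large \<open>Fmin\<close> forces the maximum of one fixed coordinate to be large, and
  the union bound for that is \<open>exp (1 - c n)\<close>.\<close>

lemma upper_tail_tendsto_0:
  fixes c :: "nat \<Rightarrow> real"
  assumes "filterlim c at_top sequentially"
  shows "(\<lambda>n. prob {\<omega> \<in> space M. Fmin (\<lambda>i. X i \<omega>) n \<ge> ln n + c n}) \<longlonglongrightarrow> 0"
proof (rule tendsto_sandwich[OF _ _ tendsto_const])
  have "\<forall>\<^sub>F n in sequentially. c n \<ge> 1"
    using assms by (simp add: filterlim_at_top)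
  thus "\<forall>\<^sub>F n in sequentially.
      prob {\<omega> \<in> space M. Fmin (\<lambda>i. X i \<omega>) n \<ge> ln n + c n} \<le> exp (1 - c n)"
    using eventually_ge_at_top[of 1]
  proof eventually_elim
    case (elim n)
    \<comment> \<open>Lowering the level by 1 makes \<open>Fmin \<le> u\<close> contradict the
      non-strict bound, at the cost of a constant factor.\<close>
    define u where "u = ln n + c n - 1"
    have u: "u \<ge> 0" using elim by (simp add: u_def add_increasing)
    obtain j :: 'd where True by simp
    have "AE \<omega> in M. \<omega> \<in> {\<omega> \<in> space M. Fmin (\<lambda>i. X i \<omega>) n \<ge> ln n + c n} \<longrightarrow>
        \<omega> \<in> {\<omega> \<in> space M. \<exists>i\<in>{1..n}. u < X i \<omega> $ j}"
      using AE_positive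
    proof eventually_elim
      case (elim \<omega>)
      show ?case
      proof safe
        assume F: "Fmin (\<lambda>i. X i \<omega>) n \<ge> ln n + c n"
        show "\<exists>i\<in>{1..n}. u < X i \<omega> $ j"
        proof (rule ccontr)
          assume "\<not> (\<exists>i\<in>{1..n}. u < X i \<omega> $ j)"
          hence "Fmin (\<lambda>i. X i \<omega>) n \<le> u"
            using u elim \<open>1 \<le> n\<close> by (intro Fmin_le_of_coord_le[where j=j]) (auto simp: not_less)
          thus False using F by (simp add: u_def)
        qed
      qed
    qed
    hence "prob {\<omega> \<in> space M. Fmin (\<lambda>i. X i \<omega>) n \<ge> ln n + c n}
        \<le> prob {\<omega> \<in> space M. \<exists>i\<in>{1..n}. u < X i \<omega> $ j}"
      by (rule finite_measure_mono_AE) simp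
    also have "\<dots> \<le> real n * exp (- u)" by (rule prob_ex_coord_gt[OF u])
    also have "\<dots> = exp (ln n) * exp (- u)" using elim by simp
    also have "\<dots> = exp (1 - c n)" by (simp add: u_def flip: exp_add)
    finally show ?case .
  qed
  have "filterlim (\<lambda>n. c n - 1) at_top sequentially"
    using filterlim_tendsto_add_at_top[OF tendsto_const[of "-1"] assms] by (simp add: add.commute)
  hence "filterlim (\<lambda>n. - (c n - 1)) at_bot sequentially"
    by (simp add: filterlim_uminus_at_top)
  hence "filterlim (\<lambda>n. 1 - c n) at_bot sequentially" by simp
  thus "(\<lambda>n. exp (1 - c n)) \<longlonglongrightarrow> 0"
    by (rule filterlim_compose[OF exp_at_bot])
qed auto

section \<open>Union bounds over grids and over families of orthants\<close>

lemma prob_ex_grid_RS_le: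
  assumes "finite G" "G \<subseteq> orthant"
  shows "prob {\<omega> \<in> space M. \<exists>y\<in>G. vsum y \<le> b \<and> y \<in> RS (\<lambda>i. X i \<omega>) n}
      \<le> real (card G) * exp (- (real n * exp (- b)))"
proof -
  let ?G = "{y\<in>G. vsum y \<le> b}"
  have "{\<omega> \<in> space M. \<exists>y\<in>G. vsum y \<le> b \<and> y \<in> RS (\<lambda>i. X i \<omega>) n} =
      (\<Union>y\<in>?G. {\<omega> \<in> space M. y \<in> RS (\<lambda>i. X i \<omega>) n})" by auto
  also have "prob \<dots> \<le> (\<Sum>y\<in>?G. prob {\<omega> \<in> space M. y \<in> RS (\<lambda>i. X i \<omega>) n})"
    using assms by (intro finite_measure_subadditive_finite) auto
  also have "\<dots> \<le> (\<Sum>y\<in>?G. exp (- (real n * exp (- b))))"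
  proof (rule sum_mono)
    fix y assume y: "y \<in> ?G"
    have "prob {\<omega> \<in> space M. y \<in> RS (\<lambda>i. X i \<omega>) n} \<le> exp (- (real n * exp (- vsum y)))"
      using y assms by (intro prob_RS_le) auto
    also have "\<dots> \<le> exp (- (real n * exp (- b)))"
      using y by (simp add: mult_left_mono)
    finally show "prob {\<omega> \<in> space M. y \<in> RS (\<lambda>i. X i \<omega>) n} \<le> exp (- (real n * exp (- b)))" .
  qed
  also have "\<dots> = real (card ?G) * exp (- (real n * exp (- b)))" by simp
  also have "\<dots> \<le> real (card G) * exp (- (real n * exp (- b)))"
    using assms by (intro mult_right_mono) (auto intro!: card_mono)
  finally show ?thesis .
qed

text \<open>Choose for each \<open>a\<close> an observation dominating \<open>z a\<close>. An
  injective choice is one of at most \<open>n ^ L\<close>, each of probability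
  \<open>exp (- b) ^ L\<close>. Otherwise one observation dominates two of the points and hence some
  \<open>w a a'\<close>; there are at most \<open>L ^ 2 * n\<close> such cases.\<close>

lemma prob_all_orthants_hit_le:
  fixes z :: "nat \<Rightarrow> real^'d"
  assumes z: "\<And>a. a < L \<Longrightarrow> z a \<in> orthant" "\<And>a. a < L \<Longrightarrow> vsum (z a) = b"
    and w: "\<And>a a'. a < a' \<Longrightarrow> a' < L \<Longrightarrow> w a a' \<in> orthant"
      "\<And>a a'. a < a' \<Longrightarrow> a' < L \<Longrightarrow> b' \<le> vsum (w a a')"
      "\<And>a a' x. a < a' \<Longrightarrow> a' < L \<Longrightarrow> vless (z a) x \<Longrightarrow> vless (z a') x \<Longrightarrow> vless (w a a') x"
  shows "prob {\<omega> \<in> space M. \<forall>a<L. \<exists>i\<in>{1..n}. vless (z a) (X i \<omega>)}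
      \<le> real n ^ L * exp (- b) ^ L + real L ^ 2 * real n * exp (- b')"
proof -
  define F where "F = {f \<in> PiE {..<L} (\<lambda>_. {1..n}). inj_on f {..<L}}"
  define T where "T = {(a, a'). a < a' \<and> a' < L} \<times> {1..n}"
  let ?A = "\<lambda>f. {\<omega> \<in> space M. \<forall>a<L. vless (z a) (X (f a) \<omega>)}"
  let ?B = "\<lambda>(p, i). {\<omega> \<in> space M. vless (w (fst p) (snd p)) (X i \<omega>)}"
  have fin: "finite F" "card F \<le> n ^ L"
  proof -
    have "finite (PiE {..<L} (\<lambda>_. {1..n}))" by (intro finite_PiE) auto
    thus "finite F" "card F \<le> n ^ L"
      using card_mono[of "PiE {..<L} (\<lambda>_. {1..n})" F] by (auto simp: F_def card_PiE)
  qed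
  have Tsub: "T \<subseteq> ({..<L} \<times> {..<L}) \<times> {1..n}" by (auto simp: T_def)
  have finT: "finite T" using finite_subset[OF Tsub] by simp
  have "card T \<le> card (({..<L} \<times> {..<L}) \<times> {1..n})" by (intro card_mono Tsub) simp
  hence cardT: "real (card T) \<le> real L ^ 2 * real n"
    by (simp add: power2_eq_square card_cartesian_product flip: of_nat_mult)
  have evA: "?A f \<in> events" if "f \<in> F" for f
  proof -
    have "f a \<ge> 1" if "a < L" for a
      using \<open>f \<in> F\<close> that by (auto simp: F_def PiE_iff)
    thus ?thesis by measurable
  qed
  have evB: "?B t \<in> events" if "t \<in> T" for t
    using that by (auto simp: T_def)
  have cover: "{\<omega> \<in> space M. \<forall>a<L. \<exists>i\<in>{1..n}. vless (z a) (X i \<omega>)} \<subseteq> (\<Union>f\<in>F. ?A f) \<union> (\<Union>t\<in>T. ?B t)"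
  proof
    fix \<omega> assume \<omega>: "\<omega> \<in> {\<omega> \<in> space M. \<forall>a<L. \<exists>i\<in>{1..n}. vless (z a) (X i \<omega>)}"
    hence "\<forall>a. \<exists>i. a < L \<longrightarrow> i \<in> {1..n} \<and> vless (z a) (X i \<omega>)" by blast
    then obtain g where g: "\<And>a. a < L \<Longrightarrow> g a \<in> {1..n} \<and> vless (z a) (X (g a) \<omega>)"
      by metis
    show "\<omega> \<in> (\<Union>f\<in>F. ?A f) \<union> (\<Union>t\<in>T. ?B t)"
    proof (cases "inj_on g {..<L}")
      case True
      have "restrict g {..<L} \<in> F"
        using g True by (auto simp: F_def inj_on_def)
      moreover have "\<omega> \<in> ?A (restrict g {..<L})" using g \<omega> by auto
      ultimately show ?thesis by blast
    next
      case False
      then obtain a a' where a: "a < a'" "a' < L" "g a = g a'"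
        unfolding inj_on_def by (metis lessThan_iff linorder_neqE_nat)
      have "((a, a'), g a) \<in> T" using a g[of a] by (auto simp: T_def)
      moreover have "\<omega> \<in> ?B ((a, a'), g a)"
        using a g[of a] g[of a'] \<omega> w(3)[OF a(1,2)] by auto
      ultimately show ?thesis by blast
    qed
  qed
  have UA: "(\<Union>f\<in>F. ?A f) \<in> events" using fin(1) evA by (rule sets.finite_UN)
  have UB: "(\<Union>t\<in>T. ?B t) \<in> events" using finT evB by (rule sets.finite_UN)
  have "prob (\<Union>f\<in>F. ?A f) \<le> (\<Sum>f\<in>F. prob (?A f))"
    using fin(1) evA by (intro finite_measure_subadditive_finite) blast+
  also have "\<dots> = (\<Sum>f\<in>F. exp (- b) ^ L)"
  proof (rule sum.cong[OF refl])
    fix f assume f: "f \<in> F"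
    have "prob (?A f) = (\<Prod>a<L. exp (- vsum (z a)))"
      using f z(1) by (intro prob_all_vless) (auto simp: F_def PiE_iff)
    thus "prob (?A f) = exp (- b) ^ L" using z(2) by simp
  qed
  also have "\<dots> = real (card F) * exp (- b) ^ L" by simp
  also have "\<dots> \<le> real n ^ L * exp (- b) ^ L"
    using fin(2) by (intro mult_right_mono) (simp_all flip: of_nat_power)
  finally have boundA: "prob (\<Union>f\<in>F. ?A f) \<le> real n ^ L * exp (- b) ^ L" .
  have "prob (\<Union>t\<in>T. ?B t) \<le> (\<Sum>t\<in>T. prob (?B t))"
    using finT evB by (intro finite_measure_subadditive_finite) blast+
  also have "\<dots> \<le> (\<Sum>t\<in>T. exp (- b'))"
  proof (rule sum_mono)
    fix t assume "t \<in> T"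
    thus "prob (?B t) \<le> exp (- b')"
      using w(1,2) by (auto simp: T_def prob_vless)
  qed
  also have "\<dots> = real (card T) * exp (- b')" by simp
  also have "\<dots> \<le> real L ^ 2 * real n * exp (- b')"
    using cardT by (intro mult_right_mono) auto
  finally have boundB: "prob (\<Union>t\<in>T. ?B t) \<le> real L ^ 2 * real n * exp (- b')" .
  have "prob {\<omega> \<in> space M. \<forall>a<L. \<exists>i\<in>{1..n}. vless (z a) (X i \<omega>)}
      \<le> prob ((\<Union>f\<in>F. ?A f) \<union> (\<Union>t\<in>T. ?B t))"
    by (rule finite_measure_mono[OF cover sets.Un[OF UA UB]])
  also have "\<dots> \<le> prob (\<Union>f\<in>F. ?A f) + prob (\<Union>t\<in>T. ?B t)"
    by (rule measure_Un_le[OF UA UB])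
  also have "\<dots> \<le> real n ^ L * exp (- b) ^ L + real L ^ 2 * real n * exp (- b')"
    by (rule add_mono[OF boundA boundB])
  finally show ?thesis .
qed

section \<open>Almost sure bounds along dyadic blocks\<close>

lemma AE_eventually_not_lower:
  "AE \<omega> in M. \<forall>\<^sub>F n in sequentially. \<not> Fmin (\<lambda>i. X i \<omega>) n \<le> ln n - 3 * ln (ln (ln n))"
proof -
  define d where "d = CARD('d)"
  \<comment> \<open>Bounds the threshold for every \<open>n\<close> of the block:
    \<open>ln n\<close> is estimated from above and the iterated logarithm from below. The extra 1
    makes the inequality strict, as \<open>Fmin_less_iff\<close> requires.\<close>
  define b where "b k = real (Suc k) * ln 2 + 1 - 3 * ln (ln (k * ln 2))" for k :: nat
  \<comment> \<open>Entries up to \<open>k + 2\<close> suffice: a point with sum below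
    \<open>b k \<le> k + 2\<close> has all coordinates below this integer, even after rounding
    up.\<close>
  define G where "G k = (\<lambda>f. \<chi> j. real (f j)) ` (PiE (UNIV :: 'd set) (\<lambda>_. {..k + 2}))" for k :: nat
  \<comment> \<open>Rounding up adds at most \<open>d\<close> to the sum. The region is taken at the
    left end of the block, where it is largest.\<close>
  define E where "E k = {\<omega> \<in> space M. \<exists>y\<in>G k. vsum y \<le> b k + d \<and> y \<in> RS (\<lambda>i. X i \<omega>) (2 ^ k)}" for k
  have finG: "finite (G k)" for k
    unfolding G_def by (intro finite_imageI finite_PiE) auto
  have Gsub: "G k \<subseteq> orthant" for k
    by (auto simp: G_def orthant_def)
  have "card (G k) \<le> card (PiE (UNIV :: 'd set) (\<lambda>_. {..k + 2}))" for k
    unfolding G_def by (intro card_image_le finite_PiE) auto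
  hence "card (G k) \<le> (k + 3) ^ d" for k
    by (simp add: card_PiE d_def numeral_3_eq_3)
  hence cardG: "real (card (G k)) \<le> real (k + 3) ^ d" for k
    by (metis of_nat_le_iff of_nat_power)
  have [measurable]: "E k \<in> events" for k
    using finG[of k] unfolding E_def by measurable
  \<comment> \<open>The losses in the exponent: \<open>ln 2\<close> from the width of the block, 1
    from strictness, \<open>d\<close> from rounding.\<close>
  define C where "C = exp (- ln 2 - 1 - real d)"
  have "\<forall>\<^sub>F k::nat in sequentially. 0 < ln (k * ln 2)" by real_asymp
  hence "\<forall>\<^sub>F k in sequentially. norm (prob (E k)) \<le> real (k + 3) ^ d * exp (- (C * ln (k * ln 2) ^ 3))"
  proof eventually_elim
    case (elim k)
    have "exp (3 * ln (ln (k * ln 2))) = ln (k * ln 2) ^ 3"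
      using elim exp_of_nat_mult[of 3 "ln (ln (k * ln 2))"] by simp
    moreover have "real (2 ^ k) = exp (real k * ln 2)" by (simp add: exp_of_nat_mult)
    moreover have "real k * ln 2 - (b k + d) = (- ln 2 - 1 - real d) + 3 * ln (ln (k * ln 2))"
      by (simp add: b_def algebra_simps)
    ultimately have "real (2 ^ k) * exp (- (b k + d)) = C * ln (k * ln 2) ^ 3"
      unfolding C_def by (metis exp_add diff_conv_add_uminus)
    hence "prob (E k) \<le> real (card (G k)) * exp (- (C * ln (k * ln 2) ^ 3))"
      using prob_ex_grid_RS_le[OF finG Gsub, of k "b k + d" "2 ^ k"] unfolding E_def by metis
    also have "\<dots> \<le> real (k + 3) ^ d * exp (- (C * ln (k * ln 2) ^ 3))"
      using cardG by (intro mult_right_mono) auto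
    finally show ?case by simp
  qed
  hence sum: "summable (\<lambda>k. prob (E k))"
    by (rule summable_comparison_test_ev) (rule summable_grid_bound, simp add: C_def)
  have large: "\<forall>\<^sub>F k::nat in sequentially. 1 < ln (k * ln 2)" by real_asymp
  show ?thesis
  proof (rule AE_eventually_not_of_dyadic[OF _ sum])
    show "AE \<omega> in M. \<forall>\<^sub>F k in sequentially. \<forall>n\<in>{2^k..<2^Suc k}.
        Fmin (\<lambda>i. X i \<omega>) n \<le> ln n - 3 * ln (ln (ln n)) \<longrightarrow> \<omega> \<in> E k"
      using AE_positive AE_space
    proof eventually_elim
      case (elim \<omega>)
      note pos = elim(1) and space = elim(2)
      show ?case using large eventually_gt_at_top[of 0]
      proof eventually_elim
        case (elim k)
        show ?case
        proof safe
          fix n :: nat assume n: "n \<in> {2^k..<2^Suc k}"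
            and F: "Fmin (\<lambda>i. X i \<omega>) n \<le> ln n - 3 * ln (ln (ln n))"
          have "n \<ge> 1" using n by (auto intro: order_trans[of _ "2^k"])
          have "real (2 ^ k) \<le> real n" "real n \<le> real (2 ^ Suc k)"
            unfolding of_nat_le_iff using n by auto
          hence nr: "2 ^ k \<le> real n" "real n \<le> 2 ^ Suc k" by simp_all
          have "ln n \<le> ln (2 ^ Suc k)" using nr \<open>n \<ge> 1\<close> by simp
          hence ln_up: "ln n \<le> real (Suc k) * ln 2" by (simp only: ln_realpow[of 2])
          have "ln (2 ^ k) \<le> ln n" using nr \<open>n \<ge> 1\<close> by simp
          hence ln_lo: "k * ln 2 \<le> ln n" by (simp only: ln_realpow[of 2])
          have kpos: "0 < k * ln 2" using elim by simp
          have "ln (k * ln 2) \<le> ln (ln n)" using ln_lo kpos by simp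
          hence "ln (ln (k * ln 2)) \<le> ln (ln (ln n))"
            using elim by (subst ln_le_cancel_iff) linarith+
          hence "Fmin (\<lambda>i. X i \<omega>) n < b k" using F ln_up by (simp add: b_def)
          moreover have "vless 0 (X 1 \<omega>)" using pos by simp
          ultimately obtain y where y: "y \<in> RS (\<lambda>i. X i \<omega>) n" "vsum y < b k"
            using Fmin_less_iff[of 1 n "\<lambda>i. X i \<omega>"] \<open>n \<ge> 1\<close> by auto
          have y0: "0 \<le> y $ j" for j using y(1) by (auto simp: RS_def orthant_def)
          have "ln (ln (k * ln 2)) \<ge> 0" using elim(1) by (intro ln_ge_zero) simp
          moreover have "real (Suc k) * ln 2 \<le> real (Suc k) * 1"
            using ln_2_less_1 by (intro mult_left_mono) auto
          ultimately have bk: "b k \<le> k + 2"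
            unfolding b_def mult_1_right of_nat_Suc by linarith
          define f where "f j = nat \<lceil>y $ j\<rceil>" for j
          have f: "y $ j \<le> real (f j)" "real (f j) \<le> y $ j + 1" for j
            using y0[of j] by (auto simp: f_def)
          have "f j \<le> k + 2" for j
          proof -
            have "y $ j \<le> vsum y" using y0 by (intro member_le_sum) auto
            hence "y $ j \<le> real (k + 2)" using y(2) bk by simp
            thus ?thesis unfolding f_def by (rule nat_ceiling_le_eq[THEN iffD2])
          qed
          hence "(\<chi> j. real (f j)) \<in> G k" by (auto simp: G_def)
          moreover have "vsum (\<chi> j. real (f j)) \<le> (\<Sum>j\<in>UNIV. y $ j + 1)"
            using f(2) by (simp add: sum_mono)
          hence "vsum (\<chi> j. real (f j)) \<le> b k + d"
            using y(2) by (simp add: sum.distrib d_def)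
          moreover have "(\<chi> j. real (f j)) \<in> RS (\<lambda>i. X i \<omega>) n"
            using f(1) by (intro RS_upward_closed[OF y(1)]) simp
          hence "(\<chi> j. real (f j)) \<in> RS (\<lambda>i. X i \<omega>) (2 ^ k)"
            using RS_antimono n by fastforce
          ultimately show "\<omega> \<in> E k" using space unfolding E_def by blast
        qed
      qed
    qed
  qed simp
qed

lemma AE_eventually_not_upper:
  assumes "CARD('d) \<ge> 2" "c > 0"
  shows "AE \<omega> in M. \<forall>\<^sub>F n in sequentially. \<not> Fmin (\<lambda>i. X i \<omega>) n \<ge> ln n + c * ln (ln n)"
proof -
  obtain j1 j2 :: 'd where j: "j1 \<noteq> j2"
  proof -
    have "\<not> (\<forall>j1 j2 :: 'd. j1 = j2)"
    proof
      assume "\<forall>j1 j2 :: 'd. j1 = j2"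
      hence "UNIV = {undefined :: 'd}" by auto
      hence "CARD('d) = card {undefined :: 'd}" by (rule arg_cong)
      thus False using assms(1) by simp
    qed
    thus ?thesis using that by blast
  qed
  \<comment> \<open>With \<open>L * (c / 2) \<ge> 2\<close> the bound for \<open>L\<close> distinct
    observations decays at least like \<open>k powr (-2)\<close>.\<close>
  obtain L :: nat where L: "4 / c \<le> L" using real_arch_simple by blast
  have "0 < 4 / c" using assms by simp
  hence Lpos: "L > 0" using L by (cases L) auto
  have Lc: "2 \<le> L * (c / 2)" using L assms by (simp add: field_simps)
  define v :: "real \<Rightarrow> real \<Rightarrow> real^'d"
    where "v s t = (\<chi> j. if j = j1 then s else if j = j2 then t else 0)" for s t
  have v_orthant: "v s t \<in> orthant" if "s \<ge> 0" "t \<ge> 0" for s t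
    using that by (auto simp: v_def orthant_def)
  have vsum_v: "vsum (v s t) = s + t" for s t
  proof -
    have "vsum (v s t) = (\<Sum>j\<in>UNIV. (if j = j1 then s else 0) + (if j = j2 then t else 0))"
      using j by (intro sum.cong) (auto simp: v_def)
    thus ?thesis by (simp add: sum.distrib)
  qed
  \<comment> \<open>Half of \<open>c\<close> is given up so that the threshold strictly exceeds
    \<open>b k\<close> throughout the block.\<close>
  define b where "b k = real k * ln 2 + (c / 2) * ln (k * ln 2)" for k :: nat
  define z where "z k a = v (a * (b k / L)) ((real L - a) * (b k / L))" for k and a :: nat
  \<comment> \<open>For \<open>a < a'\<close> this is the coordinatewise maximum of
    \<open>z k a\<close> and \<open>z k a'\<close>; its sum exceeds \<open>b k\<close> by
    \<open>(a' - a) * (b k / L)\<close>.\<close>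
  define w where "w k a a' = v (a' * (b k / L)) ((real L - a) * (b k / L))" for k and a a' :: nat
  define E where "E k = {\<omega> \<in> space M. \<forall>a<L. \<exists>i\<in>{1..2 ^ Suc k}. vless (z k a) (X i \<omega>)}" for k
  have [measurable]: "E k \<in> events" for k unfolding E_def by measurable
  \<comment> \<open>The first term comes from distinct observations. The second comes from a shared
    one, where the additional \<open>b k / L\<close> in the sum gives geometric decay.\<close>
  define g where "g k = 2 ^ L * (k * ln 2) powr (-2) + 2 * real L ^ 2 * exp (- (ln 2 / L)) ^ k" for k :: nat
  have large: "\<forall>\<^sub>F k::nat in sequentially. 1 < ln (k * ln 2)" by real_asymp
  hence "\<forall>\<^sub>F k in sequentially. norm (prob (E k)) \<le> g k"
    using eventually_gt_at_top[of 0]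
  proof eventually_elim
    case (elim k)
    have kpos: "0 < k * ln 2" using elim by simp
    have k1: "1 \<le> k * ln 2" using elim kpos by (smt (verit) ln_le_zero_iff)
    have "0 \<le> (c / 2) * ln (k * ln 2)" using k1 assms by (intro mult_nonneg_nonneg) auto
    hence bk: "k * ln 2 \<le> b k" by (simp add: b_def)
    hence b0: "b k \<ge> 0" using kpos by simp
    let ?b' = "b k + b k / L"
    have "prob (E k) \<le> real (2 ^ Suc k) ^ L * exp (- b k) ^ L + real L ^ 2 * real (2 ^ Suc k) * exp (- ?b')"
      unfolding E_def
    proof (rule prob_all_orthants_hit_le[where w="w k"])
      show "z k a \<in> orthant" if "a < L" for a
        using that b0 unfolding z_def by (intro v_orthant mult_nonneg_nonneg) auto
      show "vsum (z k a) = b k" if "a < L" for a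
        using Lpos by (simp add: z_def vsum_v field_simps)
      fix a a' assume a: "a < a'" "a' < L"
      show "w k a a' \<in> orthant"
        using a b0 unfolding w_def by (intro v_orthant mult_nonneg_nonneg) auto
      have "b k + 1 * (b k / L) \<le> b k + (real a' - real a) * (b k / L)"
        using a b0 by (intro add_left_mono mult_right_mono) auto
      also have "\<dots> = vsum (w k a a')"
        using Lpos by (simp add: w_def vsum_v field_simps)
      finally show "?b' \<le> vsum (w k a a')" by simp
      fix x assume "vless (z k a) x" "vless (z k a') x"
      moreover have "w k a a' $ i = (if i = j1 then z k a' $ i else z k a $ i)" for i
        by (simp add: w_def z_def v_def)
      ultimately show "vless (w k a a') x" by (simp add: vless_def)
    qed
    also have "real (2 ^ Suc k) ^ L * exp (- b k) ^ L = 2 ^ L * (2 ^ k * exp (- b k)) ^ L"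
      by (simp add: power_mult_distrib)
    also have "2 ^ k * exp (- b k) = (k * ln 2) powr (- (c / 2))"
    proof -
      have "(2::real) ^ k = exp (real k * ln 2)" by (simp add: exp_of_nat_mult)
      thus ?thesis using elim kpos by (simp add: b_def powr_def flip: exp_add)
    qed
    also have "\<dots> ^ L = (k * ln 2) powr (- (L * (c / 2)))"
    proof -
      have "((k * ln 2) powr (- (c / 2))) ^ L = ((k * ln 2) powr (- (c / 2))) powr real L"
        using elim(2) by (intro powr_realpow[symmetric]) simp
      also have "\<dots> = (k * ln 2) powr (- (c / 2) * real L)" by (rule powr_powr)
      also have "- (c / 2) * real L = - (L * (c / 2))" by simp
      finally show ?thesis .
    qed
    also have "real L ^ 2 * real (2 ^ Suc k) * exp (- ?b') = 2 * real L ^ 2 * (2 ^ k * exp (- ?b'))"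
      by simp
    finally have "prob (E k) \<le> 2 ^ L * (k * ln 2) powr (- (L * (c / 2)))
        + 2 * real L ^ 2 * (2 ^ k * exp (- ?b'))" .
    also have "\<dots> \<le> g k"
      unfolding g_def
    proof (intro add_mono mult_left_mono)
      show "(k * ln 2) powr (- (L * (c / 2))) \<le> (k * ln 2) powr (-2)"
        using k1 Lc by (intro powr_mono) auto
      have "b k / L \<ge> k * ln 2 / L" using bk by (intro divide_right_mono) auto
      hence "k * ln 2 - ?b' \<le> real k * (- (ln 2 / L))" using bk by simp
      hence "exp (k * ln 2 - ?b') \<le> exp (real k * (- (ln 2 / L)))" by simp
      moreover have "(2::real) ^ k = exp (real k * ln 2)" by (simp add: exp_of_nat_mult)
      ultimately show "2 ^ k * exp (- ?b') \<le> exp (- (ln 2 / L)) ^ k"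
        by (simp only: exp_of_nat_mult exp_diff exp_minus divide_inverse)
    qed auto
    finally show ?case by simp
  qed
  moreover have "summable g"
    unfolding g_def
  proof (intro summable_add summable_mult)
    have "(\<lambda>k::nat. (k * ln 2) powr (-2)) = (\<lambda>k. real k powr (-2) * ln 2 powr (-2))"
      by (simp add: powr_mult)
    thus "summable (\<lambda>k::nat. (k * ln 2) powr (-2))"
      by (simp add: summable_real_powr_iff summable_mult2)
    show "summable (\<lambda>k. exp (- (ln 2 / L)) ^ k)"
      using Lpos by (intro summable_geometric) simp
  qed
  ultimately have sum: "summable (\<lambda>k. prob (E k))" by (rule summable_comparison_test_ev)
  show ?thesis
  proof (rule AE_eventually_not_of_dyadic[OF _ sum])
    show "AE \<omega> in M. \<forall>\<^sub>F k in sequentially. \<forall>n\<in>{2^k..<2^Suc k}.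
        Fmin (\<lambda>i. X i \<omega>) n \<ge> ln n + c * ln (ln n) \<longrightarrow> \<omega> \<in> E k"
      using AE_positive AE_space
    proof eventually_elim
      case (elim \<omega>)
      note pos = elim(1) and space = elim(2)
      show ?case using large eventually_gt_at_top[of 0]
      proof eventually_elim
        case (elim k)
        show ?case
        proof safe
          fix n :: nat assume n: "n \<in> {2^k..<2^Suc k}"
            and F: "Fmin (\<lambda>i. X i \<omega>) n \<ge> ln n + c * ln (ln n)"
          have "n \<ge> 1" using n by (auto intro: order_trans[of _ "2^k"])
          have "real (2 ^ k) \<le> real n" unfolding of_nat_le_iff using n by auto
          hence "ln (2 ^ k) \<le> ln n" using \<open>n \<ge> 1\<close> by simp
          hence ln_lo: "k * ln 2 \<le> ln n" by (simp only: ln_realpow[of 2])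
          have kpos: "0 < k * ln 2" using elim by simp
          have k1: "1 \<le> k * ln 2" using elim kpos by (smt (verit) ln_le_zero_iff)
          have "(c / 2) * ln (k * ln 2) < c * ln (k * ln 2)"
            using elim(1) assms(2) by (intro mult_strict_right_mono) linarith+
          also have "\<dots> \<le> c * ln (ln n)" using ln_lo kpos assms by simp
          finally have lt: "b k < Fmin (\<lambda>i. X i \<omega>) n" using F ln_lo by (simp add: b_def)
          have b0: "b k \<ge> 0"
            unfolding b_def using kpos k1 assms by (intro add_nonneg_nonneg mult_nonneg_nonneg) auto
          have "\<exists>i\<in>{1..2 ^ Suc k}. vless (z k a) (X i \<omega>)" if a: "a < L" for a
          proof -
            have "vsum (z k a) = b k"
              using Lpos by (simp add: z_def vsum_v field_simps)
            hence "z k a \<notin> RS (\<lambda>i. X i \<omega>) n"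
              using Fmin_le[of "z k a" "\<lambda>i. X i \<omega>" n 1] lt pos \<open>n \<ge> 1\<close> by auto
            moreover have "z k a \<in> orthant"
              using a b0 unfolding z_def by (intro v_orthant mult_nonneg_nonneg) auto
            ultimately obtain i where "i \<in> {1..n}" "vless (z k a) (X i \<omega>)"
              by (auto simp: RS_def)
            moreover have "i \<in> {1..2 ^ Suc k}" using \<open>i \<in> {1..n}\<close> n by auto
            ultimately show ?thesis by blast
          qed
          thus "\<omega> \<in> E k" using space by (simp add: E_def)
        qed
      qed
    qed
  qed simp
qed

section \<open>Infinitely many low values along a sparse subsequence\<close>

lemma AE_frequently_lower:
  "AE \<omega> in M. \<exists>\<^sub>F n in sequentially. Fmin (\<lambda>i. X i \<omega>) n \<le> ln n - ln (ln (ln n))"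
proof -
  obtain j :: 'd where True by simp
  \<comment> \<open>Growth is fast enough that \<open>N k / N (Suc k)\<close> is at most
    \<open>1 / (Suc k)^2\<close>, yet slow enough that the sum of \<open>1 / ln (N (Suc k))\<close>
    diverges.\<close>
  define N :: "nat \<Rightarrow> nat" where "N k = k ^ (2 * k)" for k
  define t :: "nat \<Rightarrow> real" where "t n = ln n - ln (ln (ln n))" for n
  define u where "u k = t (N (Suc k))" for k
  define B where "B k = {N k<..N (Suc k)}" for k
  have N_step: "N k * (Suc k)\<^sup>2 \<le> N (Suc k)" for k
  proof -
    have "N k \<le> Suc k ^ (2 * k)" unfolding N_def by (intro power_mono) auto
    hence "N k * (Suc k)\<^sup>2 \<le> Suc k ^ (2 * k) * (Suc k)\<^sup>2" by (rule mult_right_mono) simp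
    also have "\<dots> = N (Suc k)" by (simp add: N_def flip: power_add)
    finally show ?thesis .
  qed
  have "N k \<le> N (Suc k)" for k
    using N_step[of k] order_trans[of "N k" "N k * (Suc k)\<^sup>2"] by simp
  hence N_mono: "mono N" by (rule mono_iff_le_Suc[THEN iffD2, OF allI])
  have N_ge: "k \<le> N k" for k
  proof (cases "k = 0")
    case False
    thus ?thesis unfolding N_def by (intro self_le_power) auto
  qed simp
  have N_lim: "filterlim (\<lambda>k. N (Suc k)) at_top sequentially"
    by (rule filterlim_at_top_mono[OF filterlim_Suc]) (simp add: N_ge)
  have ln_N: "ln (N (Suc k)) = 2 * real (Suc k) * ln (real (Suc k))" for k
    unfolding N_def by (simp add: ln_realpow del: power_Suc)
  have exp_t: "\<forall>\<^sub>F n in sequentially. exp (- t n) = ln (ln n) / n"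
  proof -
    have "\<forall>\<^sub>F n::nat in sequentially. 0 < ln (ln n)" by real_asymp
    thus ?thesis using eventually_gt_at_top[of 0]
      by eventually_elim (simp add: t_def exp_diff exp_minus)
  qed
  have t0: "\<forall>\<^sub>F n in sequentially. 0 \<le> t n" unfolding t_def by real_asymp
  have exp_u: "\<forall>\<^sub>F k in sequentially. exp (- u k) = ln (ln (N (Suc k))) / N (Suc k)"
    unfolding u_def using eventually_compose_filterlim[OF exp_t N_lim] .
  have u0: "\<forall>\<^sub>F k in sequentially. 0 \<le> u k"
    unfolding u_def using eventually_compose_filterlim[OF t0 N_lim] .

  \<comment> \<open>The earlier indices are tested against the level of the next block; since
    \<open>exp (- u k)\<close> is \<open>ln (ln (N (Suc k))) / N (Suc k)\<close>, the ratio of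
    successive \<open>N\<close> makes the union bound summable.\<close>
  have old: "AE \<omega> in M. \<forall>\<^sub>F k in sequentially.
      \<omega> \<in> space M - {\<omega> \<in> space M. \<exists>i\<in>{1..N k}. u k < X i \<omega> $ j}"
  proof (rule borel_cantelli_AE1)
    have "\<forall>\<^sub>F n::nat in sequentially. 0 \<le> ln (ln n)" by real_asymp
    from eventually_compose_filterlim[OF this N_lim] exp_u u0
    have "\<forall>\<^sub>F k in sequentially. norm (prob {\<omega> \<in> space M. \<exists>i\<in>{1..N k}. u k < X i \<omega> $ j})
        \<le> ln (2 * real (Suc k) * ln (real (Suc k))) / real (Suc k) ^ 2"
    proof eventually_elim
      case (elim k)
      have Npos: "0 < N (Suc k)" by (simp add: N_def)
      have "prob {\<omega> \<in> space M. \<exists>i\<in>{1..N k}. u k < X i \<omega> $ j} \<le> N k * exp (- u k)"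
        using elim by (intro prob_ex_coord_gt) auto
      also have "\<dots> = N k / N (Suc k) * ln (ln (N (Suc k)))" using elim by simp
      also have "\<dots> \<le> 1 / real (Suc k) ^ 2 * ln (ln (N (Suc k)))"
      proof (rule mult_right_mono)
        have "real (N k) * real (Suc k) ^ 2 \<le> real (N (Suc k))"
          using N_step[of k] by (metis of_nat_le_iff of_nat_mult of_nat_power)
        thus "N k / N (Suc k) \<le> 1 / real (Suc k) ^ 2"
          using Npos by (simp add: divide_simps del: of_nat_Suc)
      qed (use elim in auto)
      finally show ?case by (simp add: ln_N del: of_nat_Suc)
    qed
    thus "summable (\<lambda>k. prob {\<omega> \<in> space M. \<exists>i\<in>{1..N k}. u k < X i \<omega> $ j})"
      by (rule summable_comparison_test_ev[OF _ summable_lnln_div_square])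
  qed (auto simp: emeasure_eq_measure simp del: One_nat_def)

  have new: "AE \<omega> in M. \<exists>\<^sub>F k in sequentially. \<forall>i\<in>B k. X i \<omega> $ j \<le> u k"
  proof (rule borel_cantelli_AE2)
    show "indep_vars (\<lambda>_. count_space UNIV) (\<lambda>k \<omega>. \<forall>i\<in>B k. X i \<omega> $ j \<le> u k) UNIV"
    proof (rule indep_coord_blocks)
      show "disjoint_family B"
      proof -
        have "B k \<inter> B l = {}" if "k < l" for k l
          using monoD[OF N_mono, of "Suc k" l] that by (auto simp: B_def)
        thus ?thesis unfolding disjoint_family_on_def by (metis inf_commute linorder_neqE_nat)
      qed
    qed (auto simp: B_def)
    have "\<forall>\<^sub>F n::nat in sequentially. ln (ln n) / n \<le> 1" by real_asymp
    from eventually_compose_filterlim[OF this N_lim]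
      eventually_compose_filterlim[OF eventually_one_minus_lnln_power_ge N_lim] exp_u u0
    have lower: "\<forall>\<^sub>F k in sequentially.
        norm (exp (-1) / 2 * (1 / (real (Suc k) * ln (real (Suc k)))))
        \<le> prob {\<omega> \<in> space M. \<forall>i\<in>B k. X i \<omega> $ j \<le> u k}"
    proof eventually_elim
      case (elim k)
      have "norm (exp (-1) / 2 * (1 / (real (Suc k) * ln (real (Suc k))))) = exp (-1) / ln (N (Suc k))"
        by (simp add: ln_N del: of_nat_Suc)
      also have "\<dots> \<le> (1 - exp (- u k)) ^ N (Suc k)" using elim by simp
      \<comment> \<open>The block has at most \<open>N (Suc k)\<close> elements and the base lies in
        \<open>[0, 1]\<close>.\<close>
      also have "\<dots> \<le> (1 - exp (- u k)) ^ card (B k)"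
        using elim(4) by (intro power_decreasing) (auto simp: B_def)
      also have "\<dots> = prob {\<omega> \<in> space M. \<forall>i\<in>B k. X i \<omega> $ j \<le> u k}"
        using elim by (intro prob_coord_all_le[symmetric]) (auto simp: B_def)
      finally show ?case .
    qed
    show "\<not> summable (\<lambda>k. prob {\<omega> \<in> space M. \<forall>i\<in>B k. X i \<omega> $ j \<le> u k})"
    proof
      assume "summable (\<lambda>k. prob {\<omega> \<in> space M. \<forall>i\<in>B k. X i \<omega> $ j \<le> u k})"
      from summable_comparison_test_ev[OF lower this]
      have "summable (\<lambda>k. 1 / (real (Suc k) * ln (real (Suc k))))"
        by (subst (asm) summable_cmult_iff) simp
      with not_summable_inverse_mult_ln show False by simp
    qed
  qed
  from old new AE_positive show ?thesis
  proof eventually_elim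
    case (elim \<omega>)
    have "\<exists>\<^sub>F k in sequentially. Fmin (\<lambda>i. X i \<omega>) (N (Suc k)) \<le> t (N (Suc k))"
      using elim(2)
    proof (rule frequently_rev_mp)
      show "\<forall>\<^sub>F k in sequentially. (\<forall>i\<in>B k. X i \<omega> $ j \<le> u k) \<longrightarrow>
          Fmin (\<lambda>i. X i \<omega>) (N (Suc k)) \<le> t (N (Suc k))"
        using elim(1) u0
      proof eventually_elim
        case (elim k)
        show ?case
        proof
          assume blk: "\<forall>i\<in>B k. X i \<omega> $ j \<le> u k"
          \<comment> \<open>Indices up to \<open>N k\<close> are covered by \<open>old\<close>, the
            remaining ones by the block event.\<close>
          have "X i \<omega> $ j \<le> u k" if "i \<in> {1..N (Suc k)}" for i
          proof (cases "i \<le> N k")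
            case True
            thus ?thesis using elim that by (auto simp: not_less)
          next
            case False
            thus ?thesis using blk that by (auto simp: B_def)
          qed
          thus "Fmin (\<lambda>i. X i \<omega>) (N (Suc k)) \<le> t (N (Suc k))"
            unfolding u_def[symmetric] using elim \<open>\<forall>i\<ge>1. vless 0 (X i \<omega>)\<close> N_ge[of "Suc k"]
            by (intro Fmin_le_of_coord_le[where j=j]) auto
        qed
      qed
    qed
    \<comment> \<open>Eventual failure in \<open>n\<close> would persist along
      \<open>N (Suc k)\<close>, which tends to infinity.\<close>
    thus ?case
      using eventually_compose_filterlim[OF _ N_lim,
          of "\<lambda>n. \<not> Fmin (\<lambda>i. X i \<omega>) n \<le> ln n - ln (ln (ln n))"]
      unfolding frequently_def t_def by blast
  qed
qed

end

theorem theorem1p9: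
  fixes M :: "'m measure" and X :: "nat \<Rightarrow> 'm \<Rightarrow> real^'d::finite"
  assumes "prob_space M"
    and indep: "prob_space.indep_vars M (\<lambda>_. borel) (\<lambda>(i, j) \<omega>. X i \<omega> $ j) ({1..} \<times> UNIV)"
    and expo: "\<And>i j. i \<ge> 1 \<Longrightarrow> distributed M lborel (\<lambda>\<omega>. X i \<omega> $ j) (exponential_density 1)"
  shows
    "(\<forall>n. (\<lambda>\<omega>. Fmin (\<lambda>i. X i \<omega>) n) \<in> borel_measurable M)
     \<and> (\<lambda>n. measure M {\<omega> \<in> space M. Fmin (\<lambda>i. X i \<omega>) n \<le> ln n - 3 * ln (ln (ln n))}) \<longlonglongrightarrow> 0
     \<and> (\<forall>c :: nat \<Rightarrow> real. filterlim c at_top sequentially \<longrightarrow>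
          (\<lambda>n. measure M {\<omega> \<in> space M. Fmin (\<lambda>i. X i \<omega>) n \<ge> ln n + c n}) \<longlonglongrightarrow> 0)
     \<and> (CARD('d) \<ge> 2 \<longrightarrow> (\<forall>c :: real. c > 0 \<longrightarrow>
          measure M {\<omega> \<in> space M. \<exists>\<^sub>F n in sequentially.
             Fmin (\<lambda>i. X i \<omega>) n \<ge> ln n + c * ln (ln n)} = 0))
     \<and> measure M {\<omega> \<in> space M. \<exists>\<^sub>F n in sequentially.
          Fmin (\<lambda>i. X i \<omega>) n \<le> ln n - 3 * ln (ln (ln n))} = 0
     \<and> measure M {\<omega> \<in> space M. \<exists>\<^sub>F n in sequentially.
          Fmin (\<lambda>i. X i \<omega>) n \<le> ln n - ln (ln (ln n))} = 1"
proof -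
  interpret iid_exponential_vectors M X
    using assms by (simp add: iid_exponential_vectors_def iid_exponential_vectors_axioms_def)
  have io_0: "prob {\<omega> \<in> space M. \<exists>\<^sub>F n in sequentially. P n \<omega>} = 0"
    if "AE \<omega> in M. \<forall>\<^sub>F n in sequentially. \<not> P n \<omega>" for P :: "nat \<Rightarrow> 'm \<Rightarrow> bool"
  proof -
    have "prob {\<omega> \<in> space M. \<exists>\<^sub>F n in sequentially. P n \<omega>} \<le> prob {}"
      using that by (intro finite_measure_mono_AE) (auto simp: frequently_def)
    thus ?thesis by (simp add: measure_le_0_iff)
  qed
  have io_1: "prob {\<omega> \<in> space M. \<exists>\<^sub>F n in sequentially.
      Fmin (\<lambda>i. X i \<omega>) n \<le> ln n - ln (ln (ln n))} = 1"
    using AE_frequently_lower unfolding frequently_sequentially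
    by (subst prob_Collect_eq_1) measurable
  \<comment> \<open>The lower tail in probability is deduced from the almost sure lower
    bound.\<close>
  show ?thesis
    using borel_measurable_Fmin upper_tail_tendsto_0 io_1
      prob_tendsto_0_of_AE_eventually_not[OF _ AE_eventually_not_lower]
      io_0[OF AE_eventually_not_lower] io_0[OF AE_eventually_not_upper]
    by auto
qed

end
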